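(* Let $\mathcal{A}$ be a unital $C^*$-algebra, let $U$ and $V$ be Hilbert $\mathcal{A}$-modules, let $(\Omega,\mu)$ be a measure space, let $\{V_w\}_{w\in\Omega}$ be a family of closed submodules of $V$, and let $K\in End_{\mathcal{A}}^{*}(U)$. Let $\{\Lambda_w\in End_{\mathcal{A}}^{*}(U,V_w): w\in\Omega\}$ be a continuous $*$-K-g-frame for $U$ with respect to $\{V_w\}_{w\in\Omega}$ with lower and upper bounds $A,B\in\mathcal{A}$, and let $S:U\to U$, $Sx=\int_\Omega \Lambda_w^*\Lambda_w x\,d\mu(w)$, be its continuous $*$-K-g-frame operator. Then $S$ is bounded, positive and selfadjoint, and $$\|A^{-1}\|^{-2}\,\|K\|^{2}\le \|S\|\le \|B\|^{2}.$$
   Context: Hilbert $\mathcal{A}$-modules are left modules over the unital $C^*$-algebra $\mathcal{A}$ with $\mathcal{A}$-valued inner product $\langle\cdot,\cdot\rangle$, $\mathcal{A}$-linear in the first variable, and norm $\|x\|=\|\langle x,x\rangle\|^{1/2}$. $End_{\mathcal{A}}^{*}(U,W)$ is the set of adjointable operators from $U$ to $W$, and $End_{\mathcal{A}}^{*}(U)=End_{\mathcal{A}}^{*}(U,U)$. Inequalities between elements of $\mathcal{A}$ are in the usual order on selfadjoint elements. Continuous $*$-K-g-frame: given $K\in End_{\mathcal{A}}^{*}(U)$, a family $\{\Lambda_w\in End_{\mathcal{A}}^{*}(U,V_w): w\in\Omega\}$ is a continuous $*$-K-g-frame for $U$ with respect to $\{V_w\}_{w\in\Omega}$ if (1) for every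 $x\in U$ the function $w\mapsto \Lambda_w x$ (viewed as $V$-valued) is measurable, and (2) there are strictly nonzero elements $A,B\in\mathcal{A}$ (strictly nonzero means $0$ is not in the spectrum, i.e. the element is invertible) such that $$A\langle K^*x,K^*x\rangle A^*\le\int_\Omega\langle\Lambda_w x,\Lambda_w x\rangle\,d\mu(w)\le B\langle x,x\rangle B^*\quad\text{for all }x\in U.$$ $A$ and $B$ are called the lower and upper bounds. Integrals of functions with values in $\mathcal{A}$ or in a Hilbert module are Bochner integrals; in particular the integrals in the definition of the frame and of the operator $S$ are assumed to exist for every $x\in U$. *)

theory Defs
  imports "HOL-Analysis.Analysis"
begin

section \<open>Unital \<open>C\<^sup>*\<close>-algebras\<close>

text \<open>
  The real scalar multiplication, the norm and completeness come from the library classes; the class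
  below adds the complex scalar multiplication and the involution. The class
  \<^class>\<open>real_normed_algebra_1\<close> contains \<open>0 \<noteq> 1\<close> and \<open>\<parallel>1\<parallel> = 1\<close>; the latter holds in every nonzero
  unital \<open>C\<^sup>*\<close>-algebra.
\<close>

class unital_cstar_algebra = real_normed_algebra_1 + banach +
  fixes scaleC :: "complex \<Rightarrow> 'a \<Rightarrow> 'a"  (infixr \<open>*\<^sub>C\<close> 75)
    and star :: "'a \<Rightarrow> 'a"
  assumes scaleC_add_right: "c *\<^sub>C (a + b) = c *\<^sub>C a + c *\<^sub>C b"
    and scaleC_add_left: "(c + d) *\<^sub>C a = c *\<^sub>C a + d *\<^sub>C a"
    and scaleC_scaleC: "c *\<^sub>C (d *\<^sub>C a) = (c * d) *\<^sub>C a"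
    and scaleC_complex_of_real: "complex_of_real r *\<^sub>C a = r *\<^sub>R a"
    and norm_scaleC: "norm (c *\<^sub>C a) = cmod c * norm a"
    and mult_scaleC_left: "(c *\<^sub>C a) * b = c *\<^sub>C (a * b)"
    and mult_scaleC_right: "a * (c *\<^sub>C b) = c *\<^sub>C (a * b)"
    and star_add: "star (a + b) = star a + star b"
    and star_scaleC: "star (c *\<^sub>C a) = cnj c *\<^sub>C star a"
    and star_mult: "star (a * b) = star b * star a"
    and star_star: "star (star a) = a"
    and cstar_identity: "norm (star a * a) = (norm a)\<^sup>2"

definition invertible_elt :: "'a::monoid_mult \<Rightarrow> bool" where
  "invertible_elt a \<longleftrightarrow> (\<exists>b. a * b = 1 \<and> b * a = 1)"

text \<open>Meaningful only if \<open>a\<close> is invertible.\<close>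

definition inverse_elt :: "'a::monoid_mult \<Rightarrow> 'a" where
  "inverse_elt a = (THE b. a * b = 1 \<and> b * a = 1)"

lemma inverse_elt_eqI:
  assumes "a * b = 1" "b * a = 1"
  shows "inverse_elt a = b"
  unfolding inverse_elt_def
proof (rule the_equality)
  show "c = b" if "a * c = 1 \<and> c * a = 1" for c
    using assms that by (metis mult.assoc mult_1_left mult_1_right)
qed (use assms in simp)

definition spectrum :: "'a::unital_cstar_algebra \<Rightarrow> complex set" where
  "spectrum a = {c. \<not> invertible_elt (c *\<^sub>C 1 - a)}"

definition strictly_nonzero :: "'a::unital_cstar_algebra \<Rightarrow> bool" where
  "strictly_nonzero a \<longleftrightarrow> 0 \<notin> spectrum a"

definition selfadjoint_elt :: "'a::unital_cstar_algebra \<Rightarrow> bool" where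
  "selfadjoint_elt a \<longleftrightarrow> star a = a"

definition positive_elt :: "'a::unital_cstar_algebra \<Rightarrow> bool" where
  "positive_elt a \<longleftrightarrow> selfadjoint_elt a \<and> spectrum a \<subseteq> complex_of_real ` {0..}"

definition cstar_le :: "'a::unital_cstar_algebra \<Rightarrow> 'a \<Rightarrow> bool"  (infix \<open>\<preceq>\<close> 50) where
  "a \<preceq> b \<longleftrightarrow> selfadjoint_elt a \<and> selfadjoint_elt b \<and> positive_elt (b - a)"


section \<open>Hilbert modules and adjointable operators\<close>

text \<open>
  The module is the whole type \<open>'u\<close>, whose class supplies the underlying Banach space; the axioms
  \<open>act_of_real\<close> and \<open>norm_eq\<close> force its real scalar multiplication and its norm to be the ones given
  by the module structure. A complex number \<open>c\<close> acts on \<open>'u\<close> as \<open>c *\<^sub>C 1\<close>.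
\<close>

locale hilbert_module =
  fixes act :: "'a::unital_cstar_algebra \<Rightarrow> 'u::banach \<Rightarrow> 'u"
    and ip :: "'u \<Rightarrow> 'u \<Rightarrow> 'a"
  assumes act_add_right: "act a (x + y) = act a x + act a y"
    and act_add_left: "act (a + b) x = act a x + act b x"
    and act_mult: "act (a * b) x = act a (act b x)"
    and act_one: "act 1 x = x"
    and act_of_real: "act (of_real r) x = r *\<^sub>R x"
    and ip_add_left: "ip (x + y) z = ip x z + ip y z"
    and ip_act_left: "ip (act a x) y = a * ip x y"
    and ip_star: "ip y x = star (ip x y)"
    and ip_pos: "positive_elt (ip x x)"
    and ip_definite: "ip x x = 0 \<Longrightarrow> x = 0"
    and norm_eq: "norm x = sqrt (norm (ip x x))"

definition closed_submodule :: "('a \<Rightarrow> 'v \<Rightarrow> 'v) \<Rightarrow> 'v::banach set \<Rightarrow> bool" where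
  "closed_submodule act W \<longleftrightarrow>
     0 \<in> W \<and> (\<forall>x\<in>W. \<forall>y\<in>W. x + y \<in> W) \<and> (\<forall>a. \<forall>x\<in>W. act a x \<in> W) \<and> closed W"

text \<open>
  The set \<open>End*(U,W)\<close> for a submodule \<open>W\<close> of the module \<open>'v\<close>. The adjoint is only required on \<open>W\<close>:
  a closed submodule need not be complemented, so an operator adjointable into \<open>W\<close> need not be
  adjointable into \<open>'v\<close>. Linearity and boundedness follow from the existence of an adjoint.
\<close>

definition adjointable ::
  "('u \<Rightarrow> 'u \<Rightarrow> 'a) \<Rightarrow> ('v \<Rightarrow> 'v \<Rightarrow> 'a) \<Rightarrow> 'v set \<Rightarrow> ('u \<Rightarrow> 'v) set" where
  "adjointable ipU ipV W =
     {T. range T \<subseteq> W \<and> (\<exists>T'. \<forall>x. \<forall>v\<in>W. ipV (T x) v = ipU x (T' v))}"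

text \<open>For \<open>T\<close> adjointable into \<open>W\<close> this is the adjoint on \<open>W\<close>; outside \<open>W\<close> it is not meaningful.\<close>

definition adjoint_op ::
  "('u \<Rightarrow> 'u \<Rightarrow> 'a) \<Rightarrow> ('v \<Rightarrow> 'v \<Rightarrow> 'a) \<Rightarrow> ('u \<Rightarrow> 'v) \<Rightarrow> 'v \<Rightarrow> 'u" where
  "adjoint_op ipU ipV T v = (THE u. \<forall>x. ipV (T x) v = ipU x u)"

lemma (in hilbert_module) ip_right_cancel:
  assumes "\<And>x. ip x u = ip x u'"
  shows "u = u'"
proof -
  have "ip u x = ip u' x" for x
    using assms[of x] ip_star[of u x] ip_star[of u' x] by simp
  moreover have "ip u (u - u') = ip (u - u') (u - u') + ip u' (u - u')"
    using ip_add_left[of "u - u'" u' "u - u'"] by simp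
  ultimately have "ip (u - u') (u - u') = 0" by simp
  then show ?thesis using ip_definite[of "u - u'"] by simp
qed

lemma adjoint_op_eq:
  assumes "hilbert_module actU ipU" "T \<in> adjointable ipU ipV W" "v \<in> W"
  shows "ipV (T x) v = ipU x (adjoint_op ipU ipV T v)"
proof -
  obtain u where u: "\<forall>x. ipV (T x) v = ipU x u"
    using assms unfolding adjointable_def by blast
  have "adjoint_op ipU ipV T v = u"
    unfolding adjoint_op_def
  proof (rule the_equality[where P = "\<lambda>u. \<forall>x. ipV (T x) v = ipU x u"])
    show "u' = u" if "\<forall>x. ipV (T x) v = ipU x u'" for u'
      using hilbert_module.ip_right_cancel[OF assms(1), of u' u] u that by simp
  qed (rule u)
  then show ?thesis using u by simp
qed

definition selfadjoint_op :: "('u \<Rightarrow> 'u \<Rightarrow> 'a) \<Rightarrow> ('u \<Rightarrow> 'u) \<Rightarrow> bool" where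
  "selfadjoint_op ip T \<longleftrightarrow> T \<in> adjointable ip ip UNIV \<and> adjoint_op ip ip T = T"

definition positive_op :: "('u \<Rightarrow> 'u \<Rightarrow> 'a::unital_cstar_algebra) \<Rightarrow> ('u \<Rightarrow> 'u) \<Rightarrow> bool" where
  "positive_op ip T \<longleftrightarrow> T \<in> adjointable ip ip UNIV \<and> (\<forall>x. 0 \<preceq> ip (T x) x)"


section \<open>The Bochner integral in arbitrary Banach spaces\<close>

text \<open>
  The library predicate \<^const>\<open>has_bochner_integral\<close> is restricted to second countable, that is
  separable, spaces. The same definition is given here without that restriction; Borel measurability
  is replaced by strong measurability (almost everywhere a limit of simple functions), the notion on
  which the Bochner integral rests in non-separable spaces.
\<close>

definition strongly_measurable :: "'w measure \<Rightarrow> ('w \<Rightarrow> 'b::real_normed_vector) \<Rightarrow> bool" where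
  "strongly_measurable M f \<longleftrightarrow>
     (\<exists>s. (\<forall>i. simple_function M (s i)) \<and> (AE w in M. (\<lambda>i. s i w) \<longlonglongrightarrow> f w))"

definition bochner_has_integral ::
  "'w measure \<Rightarrow> ('w \<Rightarrow> 'b::banach) \<Rightarrow> 'b \<Rightarrow> bool" where
  "bochner_has_integral M f I \<longleftrightarrow>
     strongly_measurable M f \<and>
     (\<exists>s. (\<forall>i. Bochner_Integration.simple_bochner_integrable M (s i)) \<and>
          (\<lambda>i. \<integral>\<^sup>+w. ennreal (norm (f w - s i w)) \<partial>M) \<longlonglongrightarrow> 0 \<and>
          (\<lambda>i. Bochner_Integration.simple_bochner_integral M (s i)) \<longlonglongrightarrow> I)"


section \<open>Continuous \<open>*\<close>-K-g-frames\<close>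

definition continuous_star_K_g_frame ::
  "('u::banach \<Rightarrow> 'u \<Rightarrow> 'a::unital_cstar_algebra) \<Rightarrow> ('v::banach \<Rightarrow> 'v \<Rightarrow> 'a) \<Rightarrow>
   'w measure \<Rightarrow> ('w \<Rightarrow> 'v set) \<Rightarrow> ('u \<Rightarrow> 'u) \<Rightarrow>
   ('w \<Rightarrow> 'u \<Rightarrow> 'v) \<Rightarrow> 'a \<Rightarrow> 'a \<Rightarrow> bool" where
  "continuous_star_K_g_frame ipU ipV M Vw K \<Lambda> A B \<longleftrightarrow>
     (\<forall>w\<in>space M. \<Lambda> w \<in> adjointable ipU ipV (Vw w)) \<and>
     (\<forall>x. (\<lambda>w. \<Lambda> w x) \<in> borel_measurable M) \<and>
     strictly_nonzero A \<and> strictly_nonzero B \<and>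
     (\<forall>x. \<exists>I. bochner_has_integral M (\<lambda>w. ipV (\<Lambda> w x) (\<Lambda> w x)) I \<and>
        A * ipU (adjoint_op ipU ipU K x) (adjoint_op ipU ipU K x) * star A \<preceq> I \<and>
        I \<preceq> B * ipU x x * star B)"

text \<open>\<open>S x\<close> is the Bochner integral of \<open>\<Lambda>\<^sub>w\<^sup>* \<Lambda>\<^sub>w x\<close>, whose existence is part of the predicate.\<close>

definition is_frame_operator ::
  "('u::banach \<Rightarrow> 'u \<Rightarrow> 'a::unital_cstar_algebra) \<Rightarrow> ('v::banach \<Rightarrow> 'v \<Rightarrow> 'a) \<Rightarrow>
   'w measure \<Rightarrow> ('w \<Rightarrow> 'u \<Rightarrow> 'v) \<Rightarrow> ('u \<Rightarrow> 'u) \<Rightarrow> bool" where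
  "is_frame_operator ipU ipV M \<Lambda> S \<longleftrightarrow>
     (\<forall>x. bochner_has_integral M (\<lambda>w. adjoint_op ipU ipV (\<Lambda> w) (\<Lambda> w x)) (S x))"

end

theory Submission
  imports Defs
begin

text \<open>
  Applying the bounded linear map \<open>\<langle>\<cdot>, y\<rangle>\<close> to the integral that defines \<open>Sx\<close> gives
  \<open>\<langle>Sx, y\<rangle> = \<integral> \<langle>\<Lambda>\<^sub>w x, \<Lambda>\<^sub>w y\<rangle> d\<mu>(w)\<close>. The involution exchanges \<open>x\<close> and \<open>y\<close> on the right, so \<open>S\<close> is
  selfadjoint, and at \<open>y = x\<close> the frame condition reads
  \<open>A\<langle>K\<^sup>*x, K\<^sup>*x\<rangle>A\<^sup>* \<le> \<langle>Sx, x\<rangle> \<le> B\<langle>x, x\<rangle>B\<^sup>*\<close>. Hence \<open>S\<close> is positive.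

  The norm is monotone on positive elements (\<open>norm_mono_positive\<close>). The upper frame bound therefore
  gives \<open>\<parallel>\<langle>Sx, x\<rangle>\<parallel> \<le> \<parallel>B\<parallel>\<^sup>2\<parallel>x\<parallel>\<^sup>2\<close>, and the Cauchy--Schwarz inequality for the positive form
  \<open>\<langle>x, Sy\<rangle>\<close> turns this bound of the quadratic form into \<open>\<parallel>Sx\<parallel> \<le> \<parallel>B\<parallel>\<^sup>2\<parallel>x\<parallel>\<close>
  (\<open>positive_op_norm_le\<close>), which also shows that \<open>S\<close> is bounded. The lower frame bound gives
  \<open>\<parallel>K\<^sup>*x\<parallel>\<^sup>2 \<le> \<parallel>A\<^sup>-\<^sup>1\<parallel>\<^sup>2 \<parallel>\<langle>Sx, x\<rangle>\<parallel> \<le> \<parallel>A\<^sup>-\<^sup>1\<parallel>\<^sup>2 \<parallel>S\<parallel> \<parallel>x\<parallel>\<^sup>2\<close>, and \<open>\<parallel>K\<parallel> \<le> \<parallel>K\<^sup>*\<parallel>\<close> yields the lower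
  estimate.

  Positivity is a condition on the spectrum, so these steps rest on two facts about a
  selfadjoint element: its spectrum is real (\<open>spectrum_selfadjoint_real\<close>), and the spectrum contains
  a number whose modulus is the norm (\<open>spectrum_selfadjoint_attains_norm\<close>). They imply that sums of
  positive elements are positive and that \<open>-u \<le> h \<le> u\<close> entails \<open>\<parallel>h\<parallel> \<le> \<parallel>u\<parallel>\<close>. The second
  implication, applied to the values of a positive form \<open>\<phi>\<close> at \<open>y + t r\<^sup>*x\<close> and
  \<open>y - t r\<^sup>*x\<close> with \<open>r = \<phi>(x,y)\<close>, yields the Cauchy--Schwarz inequality (\<open>Cauchy_Schwarz_form\<close>).
\<close>

section \<open>Invertible elements and the spectrum\<close>

lemma inverse_elt_mult:
  assumes "invertible_elt a"
  shows "a * inverse_elt a = 1" "inverse_elt a * a = 1"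
proof -
  obtain b where b: "a * b = 1" "b * a = 1"
    using assms unfolding invertible_elt_def by blast
  then show "a * inverse_elt a = 1" "inverse_elt a * a = 1"
    using inverse_elt_eqI[OF b] by simp_all
qed

lemma invertible_elt_mult:
  assumes "invertible_elt a" "invertible_elt b"
  shows "invertible_elt (a * b)"
proof -
  have "(a * b) * (inverse_elt b * inverse_elt a) = a * (b * inverse_elt b) * inverse_elt a"
    by (simp add: mult.assoc)
  moreover have "(inverse_elt b * inverse_elt a) * (a * b) = inverse_elt b * (inverse_elt a * a) * b"
    by (simp add: mult.assoc)
  ultimately show ?thesis
    using inverse_elt_mult[OF assms(1)] inverse_elt_mult[OF assms(2)]
    unfolding invertible_elt_def by (metis mult_1_right)
qed

lemma invertible_elt_one_minus:
  fixes a :: "'a::{real_normed_algebra_1,banach}"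
  assumes "norm a < 1"
  shows "invertible_elt (1 - a)"
proof -
  have s: "summable (\<lambda>n. a ^ n)"
    by (rule complete_algebra_summable_geometric[OF assms])
  have split: "(\<Sum>n. a ^ n) = 1 + (\<Sum>n. a ^ Suc n)"
    using suminf_split_head[OF s] by simp
  have "a * (\<Sum>n. a ^ n) = (\<Sum>n. a ^ Suc n)"
    using suminf_mult[OF s, of a] by simp
  moreover have "(\<Sum>n. a ^ n) * a = (\<Sum>n. a ^ Suc n)"
    using suminf_mult2[OF s, of a] by (simp add: power_commutes)
  ultimately have "(1 - a) * (\<Sum>n. a ^ n) = 1" "(\<Sum>n. a ^ n) * (1 - a) = 1"
    using split by (simp_all add: algebra_simps)
  then show ?thesis unfolding invertible_elt_def by blast
qed

lemma norm_mult3_le: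
  fixes a b c :: "'a::real_normed_algebra"
  shows "norm (a * b * c) \<le> norm a * norm b * norm c"
  by (meson mult_right_mono norm_ge_zero norm_mult_ineq order_trans)

text \<open>
  The identity \<open>b' = b + b (a - a') b'\<close> bounds the inverse \<open>b'\<close> of a nearby element in terms of
  the inverse \<open>b\<close> of \<open>a\<close>; it yields the local boundedness of resolvents.
\<close>

lemma norm_inverse_elt_perturb:
  fixes a a' :: "'a::real_normed_algebra_1"
  assumes "invertible_elt a" "invertible_elt a'"
    and "norm (a - a') * norm (inverse_elt a) \<le> 1 / 2"
  shows "norm (inverse_elt a') \<le> 2 * norm (inverse_elt a)"
proof -
  let ?b = "inverse_elt a" and ?b' = "inverse_elt a'"
  have "?b * (a - a') * ?b' = (?b * a) * ?b' - ?b * (a' * ?b')"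
    by (simp add: algebra_simps)
  then have "?b' = ?b + ?b * (a - a') * ?b'"
    using inverse_elt_mult[OF assms(1)] inverse_elt_mult[OF assms(2)] by simp
  then have "norm ?b' \<le> norm ?b + norm (?b * (a - a') * ?b')"
    by (metis norm_triangle_ineq)
  also have "norm (?b * (a - a') * ?b') \<le> (norm ?b * norm (a - a')) * norm ?b'"
    by (rule norm_mult3_le)
  also have "\<dots> \<le> 1 / 2 * norm ?b'"
    using assms(3) by (intro mult_right_mono) (simp_all add: mult.commute)
  finally show ?thesis by simp
qed

lemma scaleC_zero [simp]: "0 *\<^sub>C a = 0"
  using scaleC_complex_of_real[of 0 a] by simp

lemma scaleC_one [simp]: "1 *\<^sub>C a = a"
  using scaleC_complex_of_real[of 1 a] by simp

lemma scaleC_minus_left: "(- c) *\<^sub>C a = - (c *\<^sub>C a)"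
  using scaleC_add_left[of c "- c" a] by (simp add: eq_neg_iff_add_eq_0 add.commute)

lemma scaleC_minus_right: "c *\<^sub>C (- a) = - (c *\<^sub>C a)"
  using scaleC_scaleC[of c "-1" a] scaleC_minus_left[of 1 a] scaleC_minus_left[of c a] by simp

lemma scaleC_diff_left: "(c - d) *\<^sub>C a = c *\<^sub>C a - d *\<^sub>C a"
  using scaleC_add_left[of c "- d" a] by (simp add: scaleC_minus_left)

lemma scaleC_diff_right: "c *\<^sub>C (a - b) = c *\<^sub>C a - c *\<^sub>C b"
  using scaleC_add_right[of c a "- b"] by (simp add: scaleC_minus_right)

lemma scaleC_of_real_one: "complex_of_real r *\<^sub>C (1::'a::unital_cstar_algebra) = of_real r"
  unfolding scaleC_complex_of_real by (simp add: of_real_def)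

lemma invertible_elt_scaleC:
  assumes "c \<noteq> 0" "invertible_elt a"
  shows "invertible_elt (c *\<^sub>C a)"
proof -
  have "(c *\<^sub>C a) * (inverse c *\<^sub>C inverse_elt a) = 1" "(inverse c *\<^sub>C inverse_elt a) * (c *\<^sub>C a) = 1"
    using assms inverse_elt_mult[OF assms(2)]
    by (simp_all add: mult_scaleC_left mult_scaleC_right scaleC_scaleC)
  then show ?thesis unfolding invertible_elt_def by blast
qed

lemma invertible_elt_uminus:
  fixes a :: "'a::unital_cstar_algebra"
  shows "invertible_elt a \<Longrightarrow> invertible_elt (- a)"
  using invertible_elt_scaleC[of "-1" a] by (simp add: scaleC_minus_left)

lemma spectrum_norm_le:
  assumes "c \<in> spectrum a"
  shows "cmod c \<le> norm a"
proof (rule ccontr)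
  assume *: "\<not> cmod c \<le> norm a"
  then have "c \<noteq> 0" by auto
  have "norm (inverse c *\<^sub>C a) = norm a / cmod c"
    by (simp add: norm_scaleC norm_inverse divide_inverse mult.commute)
  also have "\<dots> < 1" using * \<open>c \<noteq> 0\<close> by (simp add: divide_less_eq)
  finally have "norm (inverse c *\<^sub>C a) < 1" .
  then have "invertible_elt (c *\<^sub>C (1 - inverse c *\<^sub>C a))"
    using invertible_elt_one_minus invertible_elt_scaleC \<open>c \<noteq> 0\<close> by blast
  then show False
    using assms \<open>c \<noteq> 0\<close> by (simp add: spectrum_def scaleC_diff_right scaleC_scaleC)
qed

lemma spectrum_uminus: "c \<in> spectrum (- a) \<longleftrightarrow> - c \<in> spectrum a"
proof -
  have "c *\<^sub>C 1 + a = - ((- c) *\<^sub>C 1 - a)" by (simp add: scaleC_minus_left)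
  then show ?thesis
    unfolding spectrum_def
    using invertible_elt_uminus[of "c *\<^sub>C 1 + a"] invertible_elt_uminus[of "(- c) *\<^sub>C 1 - a"] by auto
qed

lemma spectrum_add_scalar: "c \<in> spectrum (d *\<^sub>C 1 + a) \<longleftrightarrow> c - d \<in> spectrum a"
  by (simp add: spectrum_def scaleC_diff_left diff_diff_eq)

lemma spectrum_scalar_minus: "c \<in> spectrum (of_real t - a) \<longleftrightarrow> of_real t - c \<in> spectrum a"
  using spectrum_add_scalar[of c "of_real t" "- a"] spectrum_uminus[of "c - of_real t" a]
  by (simp add: scaleC_of_real_one)

lemma spectrum_scaleC:
  assumes "d \<noteq> 0" "c \<in> spectrum (d *\<^sub>C a)"
  shows "c / d \<in> spectrum a"
proof -
  have "c *\<^sub>C 1 - d *\<^sub>C a = d *\<^sub>C ((c / d) *\<^sub>C 1 - a)"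
    using assms(1) by (simp add: scaleC_diff_right scaleC_scaleC)
  then show ?thesis
    using assms invertible_elt_scaleC[OF assms(1)] unfolding spectrum_def by auto
qed


section \<open>The involution and selfadjoint elements\<close>

lemma star_one [simp]: "star (1::'a::unital_cstar_algebra) = 1"
  using star_mult[of "star 1::'a" 1] by (simp add: star_star)

lemma star_scaleR: "star (r *\<^sub>R a) = r *\<^sub>R star a"
  using star_scaleC[of "of_real r" a] by (simp add: scaleC_complex_of_real)

lemma star_of_real [simp]: "star (of_real r :: 'a::unital_cstar_algebra) = of_real r"
  by (simp add: of_real_def star_scaleR)

lemma star_zero [simp]: "star (0::'a::unital_cstar_algebra) = 0"
  using star_scaleR[of 0 "0::'a"] by simp

lemma star_minus: "star (- a) = - star a"
  using star_scaleR[of "-1" a] by simp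

lemma star_diff: "star (a - b) = star a - star b"
  using star_add[of a "- b"] by (simp add: star_minus)

lemma norm_star [simp]: "norm (star a) = norm a"
proof -
  have le: "norm b \<le> norm (star b)" for b :: 'a
  proof (cases "b = 0")
    case False
    have "norm b * norm b \<le> norm (star b) * norm b"
      using cstar_identity[of b] norm_mult_ineq[of "star b" b] by (simp add: power2_eq_square)
    then show ?thesis using False by simp
  qed simp
  show ?thesis using le[of a] le[of "star a"] by (simp add: star_star)
qed

lemma bounded_linear_star: "bounded_linear star"
  by (rule bounded_linear_intro[where K = 1]) (simp_all add: star_add star_scaleR)

lemma selfadjoint_add: "selfadjoint_elt a \<Longrightarrow> selfadjoint_elt b \<Longrightarrow> selfadjoint_elt (a + b)"
  by (simp add: selfadjoint_elt_def star_add)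

lemma selfadjoint_diff: "selfadjoint_elt a \<Longrightarrow> selfadjoint_elt b \<Longrightarrow> selfadjoint_elt (a - b)"
  by (simp add: selfadjoint_elt_def star_diff)

lemma selfadjoint_of_real: "selfadjoint_elt (of_real r)"
  by (simp add: selfadjoint_elt_def)

lemma star_power: "star (a ^ n) = star a ^ n"
  by (induction n) (simp_all add: star_mult power_commutes)

lemma norm_selfadjoint_power:
  assumes "selfadjoint_elt h"
  shows "norm (h ^ (2 ^ m)) = norm h ^ (2 ^ m)"
proof (induction m)
  case (Suc m)
  let ?e = "h ^ (2 ^ m)"
  have "star ?e = ?e" using assms by (simp add: star_power selfadjoint_elt_def)
  then have "norm (?e * ?e) = (norm ?e)\<^sup>2" using cstar_identity[of ?e] by simp
  moreover have "h ^ (2 ^ Suc m) = ?e * ?e"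
    by (simp only: power_Suc mult_2 power_add)
  ultimately show ?case
    using Suc by (simp only: power_mult [symmetric] power_Suc) (simp add: mult.commute)
qed simp

text \<open>
  If \<open>\<alpha> + \<i>\<beta>\<close> lies in the spectrum of \<open>h\<close>, then \<open>\<alpha> + \<i>(\<beta> + t)\<close> lies in that of \<open>h + \<i>t\<close>, whose
  squared norm is \<open>\<parallel>h\<^sup>2 + t\<^sup>2\<parallel>\<close> by the \<open>C\<^sup>*\<close>-identity. The terms quadratic in \<open>t\<close> cancel, and letting
  the real number \<open>t\<close> vary forces \<open>\<beta> = 0\<close>.
\<close>

lemma spectrum_selfadjoint_real:
  fixes h :: "'a::unital_cstar_algebra"
  assumes h: "selfadjoint_elt h" and c: "c \<in> spectrum h"
  shows "Im c = 0"
proof -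
  have key: "(Re c)\<^sup>2 + (Im c)\<^sup>2 + 2 * Im c * t \<le> (norm h)\<^sup>2" for t
  proof -
    let ?u = "(\<i> * of_real t) *\<^sub>C 1 + h"
    have "c + \<i> * of_real t \<in> spectrum ?u"
      using c by (simp add: spectrum_add_scalar)
    then have "(cmod (c + \<i> * of_real t))\<^sup>2 \<le> (norm ?u)\<^sup>2"
      by (intro power_mono spectrum_norm_le) simp_all
    also have "(norm ?u)\<^sup>2 = norm (star ?u * ?u)" by (simp add: cstar_identity)
    also have "star ?u * ?u = of_real (t\<^sup>2) + h * h"
    proof -
      have "star ?u = - ((\<i> * of_real t) *\<^sub>C 1) + h"
        using h by (simp add: star_add star_scaleC selfadjoint_elt_def scaleC_minus_left)
      then have "star ?u * ?u = (- ((\<i> * of_real t) *\<^sub>C 1) + h) * ?u" by (simp only:)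
      also have "\<dots> = - (((\<i> * of_real t) * (\<i> * of_real t)) *\<^sub>C 1) + h * h"
        by (simp add: algebra_simps mult_scaleC_left mult_scaleC_right scaleC_scaleC scaleC_diff_right)
      also have "(\<i> * of_real t) * (\<i> * of_real t) = - complex_of_real (t\<^sup>2)"
        by (simp add: complex_eq_iff power2_eq_square)
      finally show ?thesis by (simp only: scaleC_minus_left scaleC_of_real_one) simp
    qed
    also have "norm (of_real (t\<^sup>2) + h * h) \<le> t\<^sup>2 + (norm h)\<^sup>2"
    proof -
      have "norm (of_real (t\<^sup>2) :: 'a) = t\<^sup>2" by (simp only: norm_of_real abs_power2)
      then show ?thesis
        using norm_triangle_ineq[of "of_real (t\<^sup>2)" "h * h"] norm_mult_ineq[of h h]
        unfolding power2_eq_square[of "norm h"] by linarith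
    qed
    finally show ?thesis
      unfolding cmod_power2 by (simp add: power2_sum algebra_simps)
  qed
  show ?thesis
  proof (rule ccontr)
    assume nz: "Im c \<noteq> 0"
    have "2 * Im c * (((norm h)\<^sup>2 + 1) / (2 * Im c)) = (norm h)\<^sup>2 + 1"
      using nz by simp
    then show False
      using key[of "((norm h)\<^sup>2 + 1) / (2 * Im c)"] zero_le_power2[of "Re c"] zero_le_power2[of "Im c"]
      by linarith
  qed
qed


section \<open>The spectral radius of a selfadjoint element\<close>

lemma inverse_elt_one_minus_square:
  fixes x :: "'a::unital_cstar_algebra"
  assumes "invertible_elt (1 - x)" "invertible_elt (1 + x)"
  shows "inverse_elt (1 - x * x) = (1 / 2) *\<^sub>R (inverse_elt (1 - x) + inverse_elt (1 + x))"
proof (rule inverse_elt_eqI)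
  let ?p = "inverse_elt (1 - x)" and ?n = "inverse_elt (1 + x)"
  have l: "(1 - x * x) * ?p = 1 + x" "(1 - x * x) * ?n = 1 - x"
  proof -
    have "(1 - x * x) * ?p = (1 + x) * ((1 - x) * ?p)" by (simp add: algebra_simps)
    then show "(1 - x * x) * ?p = 1 + x" by (simp add: inverse_elt_mult[OF assms(1)])
    have "(1 - x * x) * ?n = (1 - x) * ((1 + x) * ?n)" by (simp add: algebra_simps)
    then show "(1 - x * x) * ?n = 1 - x" by (simp add: inverse_elt_mult[OF assms(2)])
  qed
  have r: "?p * (1 - x * x) = 1 + x" "?n * (1 - x * x) = 1 - x"
  proof -
    have "?p * (1 - x * x) = (?p * (1 - x)) * (1 + x)" by (simp add: algebra_simps)
    then show "?p * (1 - x * x) = 1 + x" by (simp add: inverse_elt_mult[OF assms(1)])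
    have "?n * (1 - x * x) = (?n * (1 + x)) * (1 - x)" by (simp add: algebra_simps)
    then show "?n * (1 - x * x) = 1 - x" by (simp add: inverse_elt_mult[OF assms(2)])
  qed
  have half: "(1 / 2) *\<^sub>R ((1 + x) + (1 - x)) = 1" 
    by (simp add: algebra_simps scaleR_2 [symmetric] del: one_add_one)
  show "(1 - x * x) * ((1 / 2) *\<^sub>R (?p + ?n)) = 1"
    using half by (simp only: mult_scaleR_right distrib_left l)
  show "(1 / 2) *\<^sub>R (?p + ?n) * (1 - x * x) = 1"
    using half by (simp only: mult_scaleR_left distrib_right r)
qed

text \<open>
  Near each point \<open>z\<close> of the disc the resolvent is bounded by twice its norm at \<open>z\<close>, and finitely many
  such neighbourhoods cover the disc.
\<close>

lemma resolvent_bounded_on_disc: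
  fixes h :: "'a::unital_cstar_algebra"
  assumes inv: "\<And>z. cmod z \<le> 1 \<Longrightarrow> invertible_elt (1 - z *\<^sub>C h)"
  obtains C where "C > 0" "\<And>z. cmod z \<le> 1 \<Longrightarrow> norm (inverse_elt (1 - z *\<^sub>C h)) \<le> C"
proof -
  define Q where "Q z = inverse_elt (1 - z *\<^sub>C h)" for z
  \<comment> \<open>This radius makes \<open>norm_inverse_elt_perturb\<close> applicable; the summand \<open>1\<close> covers \<open>h = 0\<close>.\<close>
  define r where "r z = 1 / (2 * (norm h * norm (Q z) + 1))" for z
  have r: "r z > 0" for z
    unfolding r_def by (intro divide_pos_pos mult_pos_pos add_nonneg_pos) simp_all
  have "cball (0::complex) 1 \<subseteq> (\<Union>z\<in>cball 0 1. ball z (r z))" using r by auto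
  then obtain D where D: "D \<subseteq> cball 0 1" "finite D" "cball 0 1 \<subseteq> (\<Union>z\<in>D. ball z (r z))"
    using compactE_image[of "cball (0::complex) 1" "cball 0 1" "\<lambda>z. ball z (r z)"] by auto
  define C where "C = (\<Sum>z\<in>D. 2 * norm (Q z)) + 1"
  have "C > 0" unfolding C_def by (intro add_nonneg_pos sum_nonneg) simp_all
  moreover have "norm (Q y) \<le> C" if y: "cmod y \<le> 1" for y
  proof -
    obtain z where z: "z \<in> D" "dist z y < r z" using D(3) y by force
    have "(1 - z *\<^sub>C h) - (1 - y *\<^sub>C h) = (y - z) *\<^sub>C h" by (simp add: scaleC_diff_left)
    then have "norm ((1 - z *\<^sub>C h) - (1 - y *\<^sub>C h)) * norm (Q z) = cmod (y - z) * (norm h * norm (Q z))"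
      by (simp add: norm_scaleC)
    also have "\<dots> \<le> r z * (norm h * norm (Q z) + 1)"
      using z(2) by (intro mult_mono) (simp_all add: dist_norm norm_minus_commute less_imp_le r)
    also have "\<dots> = 1 / 2"
    proof -
      have "1 / (2 * n) * n = 1 / 2" if "n > 0" for n :: real using that by simp
      then show ?thesis unfolding r_def by (simp only: add_nonneg_pos mult_nonneg_nonneg norm_ge_zero zero_less_one)
    qed
    finally have "norm (Q y) \<le> 2 * norm (Q z)"
      unfolding Q_def using D(1) z(1) y by (intro norm_inverse_elt_perturb inv) auto
    also have "\<dots> \<le> (\<Sum>z\<in>D. 2 * norm (Q z))"
      by (rule member_le_sum[OF z(1)]) (use D in auto)
    finally show ?thesis unfolding C_def by simp
  qed
  ultimately show thesis using that unfolding Q_def by blast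
qed

text \<open>
  This is the spectral radius formula for a selfadjoint element, normalised to norm \<open>1\<close>. If the
  spectrum avoided the unit circle, the resolvents \<open>Q\<^sub>m(z) = (1 - z h\<^bsup>2^m\<^esup>)\<^bsup>-1\<^esup>\<close> would exist on the
  closed unit disc. The value of \<open>Q\<^bsub>m+1\<^esub>\<close> at \<open>z\<^sup>2\<close> is the mean of \<open>Q\<^sub>m(z)\<close> and \<open>Q\<^sub>m(-z)\<close>. Therefore a
  bound for \<open>Q\<^sub>0(tz) - Q\<^sub>0(z)\<close> that is uniform on the unit circle is inherited, with the same constant, by
  \<open>Q\<^sub>m(t\<^bsup>2^m\<^esup> z) - Q\<^sub>m(z)\<close> for all \<open>m\<close>. For fixed \<open>t < 1\<close> the first of these two terms tends to \<open>1\<close>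
  at \<open>z = 1\<close>, so that \<open>Q\<^sub>m(1)\<close> is eventually near \<open>1\<close> and \<open>h\<^bsup>2^m\<^esup>\<close> has norm less than \<open>1\<close>. But the
  \<open>C\<^sup>*\<close>-identity makes this norm equal to \<open>1\<close>.
\<close>

lemma spectrum_meets_unit_circle:
  fixes h :: "'a::unital_cstar_algebra"
  assumes sa: "selfadjoint_elt h" and nh: "norm h = 1"
  shows "\<exists>c \<in> spectrum h. cmod c = 1"
proof (rule ccontr)
  assume none: "\<not> (\<exists>c \<in> spectrum h. cmod c = 1)"
  define e where "e m = h ^ (2 ^ m)" for m
  have e_Suc: "e (Suc m) = e m * e m" for m
    unfolding e_def by (simp only: power_Suc mult_2 power_add)
  have ne: "norm (e m) = 1" for m
    using norm_selfadjoint_power[OF sa, of m] nh by (simp add: e_def)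
  have inv0: "invertible_elt (1 - z *\<^sub>C h)" if "cmod z \<le> 1" for z
  proof (cases "z = 0")
    case True
    then show ?thesis by (auto simp: invertible_elt_def)
  next
    case False
    have "inverse z \<notin> spectrum h"
    proof
      assume "inverse z \<in> spectrum h"
      with none have "cmod (inverse z) \<noteq> 1" and "cmod (inverse z) \<le> 1"
        using spectrum_norm_le nh by fastforce+
      moreover have "cmod z * cmod (inverse z) = 1" using False by (simp add: norm_inverse)
      moreover have "cmod z * cmod (inverse z) \<le> 1 * cmod (inverse z)"
        using that by (intro mult_right_mono) simp_all
      ultimately show False by linarith
    qed
    then have "invertible_elt (z *\<^sub>C (inverse z *\<^sub>C 1 - h))"
      using False by (intro invertible_elt_scaleC) (simp_all add: spectrum_def)
    then show ?thesis using False by (simp add: scaleC_diff_right scaleC_scaleC)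
  qed
  have sq: "1 - (v * v) *\<^sub>C e (Suc m) = 1 - (v *\<^sub>C e m) * (v *\<^sub>C e m)" for v m
    by (simp add: e_Suc mult_scaleC_left mult_scaleC_right scaleC_scaleC)
  have inv: "invertible_elt (1 - z *\<^sub>C e m)" if "cmod z \<le> 1" for z m
    using that
  proof (induction m arbitrary: z)
    case 0
    then show ?case using inv0 by (simp add: e_def)
  next
    case (Suc m)
    have v: "csqrt z * csqrt z = z" using power2_csqrt[of z] by (simp add: power2_eq_square)
    have "cmod (csqrt z) \<le> 1"
      using Suc.prems by (simp add: norm_csqrt)
    then have "invertible_elt ((1 - csqrt z *\<^sub>C e m) * (1 - (- csqrt z) *\<^sub>C e m))"
      by (intro invertible_elt_mult Suc.IH) simp_all
    moreover have "(1 - csqrt z *\<^sub>C e m) * (1 - (- csqrt z) *\<^sub>C e m) = 1 - (csqrt z *\<^sub>C e m) * (csqrt z *\<^sub>C e m)"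
      by (simp add: algebra_simps scaleC_minus_left)
    ultimately show ?case using sq[of "csqrt z" m] v by simp
  qed
  define Q where "Q m z = inverse_elt (1 - z *\<^sub>C e m)" for m z
  have Q: "(1 - z *\<^sub>C e m) * Q m z = 1" "Q m z * (1 - z *\<^sub>C e m) = 1" if "cmod z \<le> 1" for m z
    unfolding Q_def using inverse_elt_mult[OF inv[OF that]] by simp_all
  have mean: "Q (Suc m) (v * v) = (1 / 2) *\<^sub>R (Q m v + Q m (- v))" if "cmod v \<le> 1" for m v
    using inverse_elt_one_minus_square[of "v *\<^sub>C e m"] inv[of v m] inv[of "- v" m] that
    unfolding Q_def sq by (simp add: scaleC_minus_left)
  obtain C where C: "C > 0" "\<And>z. cmod z \<le> 1 \<Longrightarrow> norm (Q 0 z) \<le> C"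
    using resolvent_bounded_on_disc[of h] inv0 unfolding Q_def e_def by auto
  \<comment> \<open>By the resolvent identity, \<open>C (1 - t) C\<close> bounds \<open>Q\<^sub>0(tz) - Q\<^sub>0(z)\<close> on the unit circle.\<close>
  define t where "t = 1 - 1 / (8 * C\<^sup>2 + 1)"
  have t: "0 \<le> t" "t < 1" "C * (1 - t) * C \<le> 1 / 8"
  proof -
    have d: "8 * C\<^sup>2 + 1 > 0" by (simp add: add_nonneg_pos)
    then show "0 \<le> t" "t < 1" unfolding t_def by (simp_all add: divide_le_eq)
    have "C * (1 - t) * C = C\<^sup>2 / (8 * C\<^sup>2 + 1)" unfolding t_def by (simp add: power2_eq_square)
    also have "\<dots> \<le> 1 / 8" using d by (simp add: divide_le_eq)
    finally show "C * (1 - t) * C \<le> 1 / 8" .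
  qed
  have small: "norm (Q m (of_real (t ^ (2 ^ m)) * w) - Q m w) \<le> 1 / 8" if "cmod w = 1" for m w
    using that
  proof (induction m arbitrary: w)
    case 0
    let ?z = "of_real t * w"
    have z: "cmod ?z \<le> 1" and w: "cmod w \<le> 1" using 0 t by (simp_all add: norm_mult)
    have "Q 0 ?z * ((1 - w *\<^sub>C e 0) - (1 - ?z *\<^sub>C e 0)) * Q 0 w =
        Q 0 ?z * ((1 - w *\<^sub>C e 0) * Q 0 w) - (Q 0 ?z * (1 - ?z *\<^sub>C e 0)) * Q 0 w"
      by (simp add: algebra_simps)
    then have "Q 0 ?z - Q 0 w = Q 0 ?z * ((?z - w) *\<^sub>C e 0) * Q 0 w"
      using Q[OF z, of 0] Q[OF w, of 0] by (simp add: scaleC_diff_left)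
    then have "norm (Q 0 ?z - Q 0 w) \<le> norm (Q 0 ?z) * norm ((?z - w) *\<^sub>C e 0) * norm (Q 0 w)"
      by (simp only: norm_mult3_le)
    also have "norm ((?z - w) *\<^sub>C e 0) = 1 - t"
    proof -
      have "?z - w = of_real (t - 1) * w" by (simp add: algebra_simps)
      then show ?thesis using 0 t ne by (simp only: norm_scaleC norm_mult norm_of_real) simp
    qed
    also have "norm (Q 0 ?z) * (1 - t) * norm (Q 0 w) \<le> C * (1 - t) * C"
      using C z w t by (intro mult_mono) simp_all
    finally show ?case using t(3) by simp
  next
    case (Suc m)
    let ?v = "csqrt w" and ?s = "complex_of_real (t ^ (2 ^ m))"
    have v: "?v * ?v = w" using power2_csqrt[of w] by (simp add: power2_eq_square)
    have nv: "cmod ?v = 1" using Suc.prems by (simp add: norm_csqrt)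
    have s: "cmod (?s * ?v) \<le> 1"
      using t nv by (simp add: norm_mult norm_power power_le_one)
    have ss: "of_real (t ^ (2 ^ Suc m)) * w = (?s * ?v) * (?s * ?v)"
    proof -
      have "t ^ (2 ^ Suc m) = t ^ (2 ^ m) * t ^ (2 ^ m)" by (simp only: power_Suc mult_2 power_add)
      then show ?thesis by (subst v[symmetric]) (simp only: of_real_mult mult_ac)
    qed
    have "Q (Suc m) (of_real (t ^ (2 ^ Suc m)) * w) - Q (Suc m) w =
        (1 / 2) *\<^sub>R ((Q m (?s * ?v) - Q m ?v) + (Q m (?s * (- ?v)) - Q m (- ?v)))"
      using mean[OF s, of m] mean[of ?v m] nv unfolding ss v by (simp add: algebra_simps)
    also have "norm \<dots> \<le> (1 / 2) * (norm (Q m (?s * ?v) - Q m ?v) + norm (Q m (?s * (- ?v)) - Q m (- ?v)))"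
      unfolding norm_scaleR by (simp add: norm_triangle_ineq)
    also have "\<dots> \<le> 1 / 8"
      using Suc.IH[of ?v] Suc.IH[of "- ?v"] nv by simp
    finally show ?case .
  qed
  obtain m where m: "t ^ m < 1 / 16" using real_arch_pow_inv[of "1/16" t] t by auto
  define s where "s = t ^ (2 ^ m)"
  have "m \<le> 2 ^ m" using less_exp[of m] by simp
  then have s: "0 \<le> s" "s \<le> 1 / 16"
    unfolding s_def using t m power_decreasing[of m "2 ^ m" t] by simp_all
  have cs: "cmod (of_real s) \<le> 1" using s by simp
  let ?P = "Q m (of_real s)" and ?R = "Q m 1"
  have P: "?P = 1 + of_real s *\<^sub>C (e m * ?P)"
    using Q(1)[OF cs, of m] by (simp add: algebra_simps mult_scaleC_left)
  have eP: "norm (e m * ?P) \<le> norm ?P" using norm_mult_ineq[of "e m" ?P] ne by simp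
  have P1: "norm (?P - 1) \<le> s * norm ?P"
  proof -
    have "?P - 1 = of_real s *\<^sub>C (e m * ?P)" using P by (simp add: algebra_simps)
    then have "norm (?P - 1) = s * norm (e m * ?P)" using s by (simp add: norm_scaleC)
    then show ?thesis using eP s by (simp add: mult_left_mono)
  qed
  moreover have "norm ?P \<le> 1 + norm (?P - 1)"
    using norm_triangle_ineq[of 1 "?P - 1"] by simp
  moreover have "s * norm ?P \<le> 1 / 16 * norm ?P" using s by (intro mult_right_mono) simp_all
  ultimately have "norm (?P - 1) \<le> 1 / 8" by simp
  moreover have "norm (?P - ?R) \<le> 1 / 8" using small[of 1 m] by (simp add: s_def)
  ultimately have R: "norm (?R - 1) \<le> 1 / 4"
    using norm_triangle_ineq[of "?R - ?P" "?P - 1"] by (simp add: norm_minus_commute)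
  have "e m = (?R - 1) * (1 - e m)"
    using Q(2)[of 1 m] by (simp add: algebra_simps)
  then have "norm (e m) \<le> norm (?R - 1) * norm (1 - e m)"
    by (metis norm_mult_ineq)
  also have "\<dots> \<le> (1 / 4) * 2"
    using R norm_triangle_ineq4[of 1 "e m"] ne[of m] by (intro mult_mono) simp_all
  finally show False using ne[of m] by simp
qed

lemma spectrum_selfadjoint_attains_norm:
  fixes h :: "'a::unital_cstar_algebra"
  assumes sa: "selfadjoint_elt h"
  obtains s where "complex_of_real s \<in> spectrum h" "\<bar>s\<bar> = norm h"
proof -
  have "\<exists>c\<in>spectrum h. cmod c = norm h"
  proof (cases "h = 0")
    case True
    have "0 \<in> spectrum (0::'a)" by (simp add: spectrum_def invertible_elt_def)
    then show ?thesis using True by auto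
  next
    case False
    let ?r = "inverse (norm h)"
    have "selfadjoint_elt (?r *\<^sub>R h)"
      using sa by (simp add: selfadjoint_elt_def star_scaleR)
    then obtain c where c: "c \<in> spectrum (?r *\<^sub>R h)" "cmod c = 1"
      using spectrum_meets_unit_circle[of "?r *\<^sub>R h"] False by auto
    have "c / of_real ?r \<in> spectrum h"
      using c(1) False spectrum_scaleC[of "of_real ?r" c h]
      by (simp only: scaleC_complex_of_real) simp
    moreover have "cmod (c / of_real ?r) = norm h"
      using c(2) by (simp add: norm_divide norm_inverse flip: inverse_eq_divide)
    ultimately show ?thesis by blast
  qed
  then obtain c where c: "c \<in> spectrum h" "cmod c = norm h" by blast
  have "c = of_real (Re c)"
    using spectrum_selfadjoint_real[OF sa c(1)] by (simp add: complex_eq_iff)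
  then show thesis using that[of "Re c"] c by (metis norm_of_real)
qed


section \<open>Positive elements\<close>

lemma spectrum_positive:
  assumes "positive_elt h" "of_real s \<in> spectrum h"
  shows "0 \<le> s"
  using assms unfolding positive_elt_def by auto

text \<open>
  The inequality places the spectrum of \<open>h\<close> in the disc of radius \<open>t\<close> around \<open>t\<close>, whose real points
  are nonnegative. Together with its converse below it replaces the spectrum by a norm condition, so
  that the triangle inequality shows that sums of positive elements are positive.
\<close>

lemma positive_eltI_norm:
  assumes "selfadjoint_elt h" "norm (of_real t - h) \<le> t"
  shows "positive_elt h"
proof -
  have "c \<in> complex_of_real ` {0..}" if c: "c \<in> spectrum h" for c
  proof -
    have re: "c = of_real (Re c)"
      using spectrum_selfadjoint_real[OF assms(1) c] by (simp add: complex_eq_iff)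
    have "of_real t - c \<in> spectrum (of_real t - h)"
      using c by (simp add: spectrum_scalar_minus)
    then have "cmod (of_real (t - Re c)) \<le> t"
      using spectrum_norm_le assms(2) re by (metis of_real_diff order_trans)
    then have "0 \<le> Re c" unfolding norm_of_real by linarith
    then show ?thesis using re by (metis atLeast_iff image_eqI)
  qed
  then show ?thesis using assms(1) by (auto simp: positive_elt_def)
qed

lemma positive_elt_norm_le:
  assumes "positive_elt h"
  shows "norm (of_real (norm h) - h) \<le> norm h"
proof -
  have sa: "selfadjoint_elt (of_real (norm h) - h)"
    using assms by (simp add: positive_elt_def selfadjoint_diff selfadjoint_of_real)
  obtain s where s: "of_real s \<in> spectrum (of_real (norm h) - h)" "\<bar>s\<bar> = norm (of_real (norm h) - h)"
    by (rule spectrum_selfadjoint_attains_norm[OF sa])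
  have sp: "of_real (norm h - s) \<in> spectrum h"
    using s(1) by (simp add: spectrum_scalar_minus)
  have "0 \<le> norm h - s" using spectrum_positive[OF assms sp] .
  moreover have "norm h - s \<le> norm h"
    using spectrum_norm_le[OF sp] unfolding norm_of_real by linarith
  ultimately show ?thesis using s(2) by linarith
qed

lemma positive_elt_add:
  assumes "positive_elt a" "positive_elt b"
  shows "positive_elt (a + b)"
proof (rule positive_eltI_norm)
  show "selfadjoint_elt (a + b)" using assms by (simp add: positive_elt_def selfadjoint_add)
  have "of_real (norm a + norm b) - (a + b) = (of_real (norm a) - a) + (of_real (norm b) - b)"
    by simp
  then show "norm (of_real (norm a + norm b) - (a + b)) \<le> norm a + norm b"
    using norm_triangle_mono[OF assms[THEN positive_elt_norm_le]] by metis
qed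

lemma positive_elt_norm_minus:
  assumes "selfadjoint_elt u"
  shows "positive_elt (of_real (norm u) - u)"
  by (rule positive_eltI_norm[where t = "norm u"])
    (simp_all add: assms selfadjoint_diff selfadjoint_of_real)

text \<open>
  The norm of \<open>h\<close> may be attained at the positive or at the negative end of the spectrum. In the first
  case \<open>h \<le> u \<le> \<parallel>u\<parallel>\<close> bounds it, in the second case \<open>-h \<le> u \<le> \<parallel>u\<parallel>\<close> does.
\<close>

lemma norm_le_of_both_sides:
  assumes h: "selfadjoint_elt h" and u: "selfadjoint_elt u"
    and pos: "positive_elt (u - h)" "positive_elt (u + h)"
  shows "norm h \<le> norm u"
proof -
  have upper: "s \<le> norm u" if "of_real s \<in> spectrum k" "positive_elt (u - k)" for s k
  proof -
    have "positive_elt ((of_real (norm u) - u) + (u - k))"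
      by (intro positive_elt_add positive_elt_norm_minus u that(2))
    moreover have "of_real (norm u - s) \<in> spectrum (of_real (norm u) - k)"
      using that(1) by (simp add: spectrum_scalar_minus)
    ultimately show ?thesis using spectrum_positive[of "of_real (norm u) - k" "norm u - s"] by simp
  qed
  obtain s where s: "of_real s \<in> spectrum h" "\<bar>s\<bar> = norm h"
    by (rule spectrum_selfadjoint_attains_norm[OF h])
  have "of_real (- s) \<in> spectrum (- h)" using s(1) by (simp add: spectrum_uminus)
  then have "- s \<le> norm u" using upper[of "- s" "- h"] pos(2) by simp
  moreover have "s \<le> norm u" using upper[OF s(1)] pos(1) by simp
  ultimately show ?thesis using s(2) by linarith
qed

lemma norm_mono_positive:
  assumes "positive_elt a" "a \<preceq> b"
  shows "norm a \<le> norm b"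
proof (rule norm_le_of_both_sides)
  show "positive_elt (b + a)"
  proof -
    have "b + a = a + (a + (b - a))" by (simp add: add.commute)
    then show ?thesis using assms positive_elt_add unfolding cstar_le_def by metis
  qed
qed (use assms in \<open>simp_all add: cstar_le_def\<close>)

lemma positive_elt_mono:
  assumes "positive_elt a" "a \<preceq> b"
  shows "positive_elt b"
  using positive_elt_add[of a "b - a"] assms by (simp add: cstar_le_def)


section \<open>Hilbert modules\<close>

context hilbert_module
begin

lemma ip_act_right: "ip x (act a y) = ip x y * star a"
  using ip_star[of x "act a y"] ip_star[of x y] by (simp add: ip_act_left star_mult)

lemma ip_scaleR_left: "ip (r *\<^sub>R x) y = r *\<^sub>R ip x y"
  using ip_act_left[of "of_real r" x y] unfolding act_of_real by (simp add: of_real_def)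

lemma norm_ip_self: "norm (ip x x) = (norm x)\<^sup>2"
  by (simp add: norm_eq)

lemma ip_left_cancel: "(\<And>z. ip x z = ip y z) \<Longrightarrow> x = y"
  using ip_right_cancel[of x y] by (metis ip_star)

end

text \<open>
  Let \<open>r = \<phi>(x,y)\<close>. Expanding the form at \<open>y - t r\<^sup>*x\<close> gives \<open>2t r\<^sup>*r \<le> u\<close> with
  \<open>u = \<phi>(y,y) + t\<^sup>2 r\<^sup>*\<phi>(x,x)r\<close>. Expanding it at \<open>y + t r\<^sup>*x\<close> as well gives \<open>-u \<le> 2t r\<^sup>*r\<close>, and
  the two inequalities together bound \<open>\<parallel>r\<^sup>*r\<parallel> = \<parallel>r\<parallel>\<^sup>2\<close> whatever the sign of \<open>r\<^sup>*r\<close>. The choice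
  \<open>t = 1/\<parallel>\<phi>(x,x)\<parallel>\<close> then gives the claim; if \<open>\<phi>(x,x) = 0\<close>, a large \<open>t\<close> shows \<open>r = 0\<close>.
\<close>

theorem Cauchy_Schwarz_form:
  fixes \<phi> :: "'u::ab_group_add \<Rightarrow> 'u \<Rightarrow> 'a::unital_cstar_algebra" and act :: "'a \<Rightarrow> 'u \<Rightarrow> 'u"
  assumes add: "\<And>x y z. \<phi> (x + y) z = \<phi> x z + \<phi> y z"
    and act: "\<And>a x y. \<phi> (act a x) y = a * \<phi> x y"
    and herm: "\<And>x y. \<phi> y x = star (\<phi> x y)"
    and pos: "\<And>x. positive_elt (\<phi> x x)"
  shows "(norm (\<phi> x y))\<^sup>2 \<le> norm (\<phi> x x) * norm (\<phi> y y)"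
proof -
  define p q r where "p = \<phi> x x" and "q = \<phi> y y" and "r = \<phi> x y"
  have add2: "\<phi> x (y + z) = \<phi> x y + \<phi> x z" for x y z
    using herm[of x "y + z"] herm[of x y] herm[of x z] by (simp add: add star_add)
  have act2: "\<phi> x (act a y) = \<phi> x y * star a" for x a y
    using herm[of x "act a y"] herm[of x y] by (simp add: act star_mult)
  have sp: "star p = p" and sq: "star q = q" using herm[of x x] herm[of y y] by (simp_all add: p_def q_def)
  have expand: "\<phi> (y + act (s *\<^sub>R star r) x) (y + act (s *\<^sub>R star r) x)
      = q + s\<^sup>2 *\<^sub>R (star r * p * r) + (2 * s) *\<^sub>R (star r * r)" for s
    using herm[of y x]
    by (simp add: add add2 act act2 p_def[symmetric] q_def[symmetric] r_def[symmetric]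
        star_scaleR star_star algebra_simps power2_eq_square scaleR_2 flip: scaleR_scaleR)
  have bound: "2 * t * (norm r)\<^sup>2 \<le> norm q + t\<^sup>2 * norm p * (norm r)\<^sup>2" if "t > 0" for t :: real
  proof -
    let ?u = "q + t\<^sup>2 *\<^sub>R (star r * p * r)" and ?h = "(2 * t) *\<^sub>R (star r * r)"
    have "norm ?h \<le> norm ?u"
    proof (rule norm_le_of_both_sides)
      show "selfadjoint_elt ?h" "selfadjoint_elt ?u"
        using sp sq by (simp_all add: selfadjoint_elt_def star_add star_scaleR star_mult star_star mult.assoc)
      show "positive_elt (?u + ?h)"
        using pos[of "y + act (t *\<^sub>R star r) x"] by (simp only: expand)
      show "positive_elt (?u - ?h)"
        using pos[of "y + act ((- t) *\<^sub>R star r) x"] unfolding expand by simp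
    qed
    moreover have "norm ?h = 2 * t * (norm r)\<^sup>2"
      using that by (simp add: cstar_identity)
    moreover have "norm ?u \<le> norm q + t\<^sup>2 * norm p * (norm r)\<^sup>2"
    proof -
      have "norm (star r * p * r) \<le> norm r * norm p * norm r"
        using norm_mult3_le[of "star r" p r] by simp
      then have "t\<^sup>2 * norm (star r * p * r) \<le> t\<^sup>2 * norm p * (norm r)\<^sup>2"
        using mult_left_mono[of _ _ "t\<^sup>2"] by (fastforce simp: power2_eq_square mult_ac)
      then show ?thesis
        using norm_triangle_ineq[of q "t\<^sup>2 *\<^sub>R (star r * p * r)"] by simp
    qed
    ultimately show ?thesis by linarith
  qed
  show ?thesis
  proof (cases "norm p = 0")
    case True
    have "norm r = 0"
    proof (rule ccontr)
      assume nz: "norm r \<noteq> 0"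
      have "2 * ((norm q + 1) / (norm r)\<^sup>2) * (norm r)\<^sup>2 \<le> norm q"
        using bound[of "(norm q + 1) / (norm r)\<^sup>2"] nz True by (simp add: add_nonneg_pos)
      then have "2 * norm q + 2 \<le> norm q" using nz by simp
      then show False using norm_ge_zero[of q] by linarith
    qed
    then show ?thesis by (simp add: r_def)
  next
    case False
    have "2 * (1 / norm p) * (norm r)\<^sup>2 \<le> norm q + (1 / norm p)\<^sup>2 * norm p * (norm r)\<^sup>2"
      using bound[of "1 / norm p"] False by simp
    also have "(1 / norm p)\<^sup>2 * norm p * (norm r)\<^sup>2 = (norm r)\<^sup>2 / norm p"
      using False by (simp add: power2_eq_square field_simps)
    finally have "(norm r)\<^sup>2 / norm p \<le> norm q" by (simp add: field_simps)
    then show ?thesis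
      using False by (simp add: p_def q_def r_def divide_le_eq mult.commute)
  qed
qed

context hilbert_module
begin

lemma norm_ip_le: "norm (ip x y) \<le> norm x * norm y"
proof -
  have "(norm (ip x y))\<^sup>2 \<le> (norm x * norm y)\<^sup>2"
    using Cauchy_Schwarz_form[of ip act, OF ip_add_left ip_act_left ip_star ip_pos]
    by (simp add: norm_ip_self power_mult_distrib)
  then show ?thesis by (rule power2_le_imp_le) simp
qed

lemma bounded_linear_ip_left: "bounded_linear (\<lambda>x. ip x y)"
  by (rule bounded_linear_intro[where K = "norm y"])
    (simp_all add: ip_add_left ip_scaleR_left norm_ip_le)

lemma symmetric_op_selfadjoint:
  assumes "\<And>x y. ip (T x) y = ip x (T y)"
  shows "selfadjoint_op ip T"
proof -
  have T: "T \<in> adjointable ip ip UNIV" unfolding adjointable_def using assms by blast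
  have "adjoint_op ip ip T v = T v" for v
    using adjoint_op_eq[OF hilbert_module_axioms T, of v] assms
    by (intro ip_right_cancel) simp
  then show ?thesis using T unfolding selfadjoint_op_def by blast
qed

text \<open>
  The Cauchy--Schwarz inequality is applied to the form \<open>(x, y) \<mapsto> \<langle>x, Ty\<rangle>\<close> at \<open>y = Tx\<close>, where its
  value is \<open>\<langle>Tx, Tx\<rangle>\<close>. Since \<open>T\<close> acts on the second argument, linearity in \<open>x\<close> is that of
  the inner product, and the inequality can serve to establish the continuity of \<open>T\<close>.
\<close>

lemma positive_op_norm_le:
  assumes sym: "\<And>x y. ip (T x) y = ip x (T y)"
    and pos: "\<And>x. positive_elt (ip (T x) x)"
    and le: "\<And>x. norm (ip (T x) x) \<le> b * (norm x)\<^sup>2" and "0 \<le> b"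
  shows "norm (T x) \<le> b * norm x"
proof (cases "norm (T x) = 0")
  case False
  have "(norm (ip x (T (T x))))\<^sup>2 \<le> norm (ip x (T x)) * norm (ip (T x) (T (T x)))"
  proof (rule Cauchy_Schwarz_form[of "\<lambda>x y. ip x (T y)" act])
    show "ip v (T u) = star (ip u (T v))" for u v
      using ip_star[of v "T u"] by (simp only: sym)
    show "positive_elt (ip u (T u))" for u using pos[of u] by (simp only: sym)
  qed (rule ip_add_left ip_act_left)+
  also have "ip x (T (T x)) = ip (T x) (T x)" by (simp add: sym)
  also have "norm (ip x (T x)) * norm (ip (T x) (T (T x))) \<le> (b * (norm x)\<^sup>2) * (b * (norm (T x))\<^sup>2)"
    using le[of x] le[of "T x"] \<open>0 \<le> b\<close> by (intro mult_mono) (simp_all add: sym)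
  finally have "(norm (T x))\<^sup>2 * (norm (T x))\<^sup>2 \<le> (b * norm x)\<^sup>2 * (norm (T x))\<^sup>2"
    by (simp add: norm_ip_self power2_eq_square mult_ac)
  then have "(norm (T x))\<^sup>2 \<le> (b * norm x)\<^sup>2"
    by (rule mult_right_le_imp_le) (use False in simp)
  then show ?thesis by (rule power2_le_imp_le) (simp add: \<open>0 \<le> b\<close>)
qed (simp add: \<open>0 \<le> b\<close>)

lemma adjoint_pair_linear:
  assumes adj: "\<And>x y. ip (T x) y = ip x (T' y)"
  shows "linear T"
proof (rule linearI)
  show "T (x + y) = T x + T y" for x y
    by (rule ip_left_cancel) (simp add: adj ip_add_left)
  show "T (r *\<^sub>R x) = r *\<^sub>R T x" for r x
    by (rule ip_left_cancel) (simp add: adj ip_scaleR_left)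
qed

text \<open>The reason is \<open>\<parallel>Tx\<parallel>\<^sup>2 = \<parallel>\<langle>x, T'Tx\<rangle>\<parallel> \<le> \<parallel>x\<parallel> b \<parallel>Tx\<parallel>\<close>.\<close>

lemma adjoint_pair_norm_le:
  assumes adj: "\<And>x y. ip (T x) y = ip x (T' y)"
    and le: "\<And>x. norm (T' x) \<le> b * norm x" and "0 \<le> b"
  shows "norm (T x) \<le> b * norm x"
proof (cases "norm (T x) = 0")
  case False
  have "norm (T x) * norm (T x) = norm (ip x (T' (T x)))"
    using norm_ip_self[of "T x"] by (simp add: adj power2_eq_square)
  also have "\<dots> \<le> norm x * (b * norm (T x))"
    using norm_ip_le[of x "T' (T x)"] mult_left_mono[OF le[of "T x"], of "norm x"] by simp
  finally have "norm (T x) * norm (T x) \<le> (b * norm x) * norm (T x)" by (simp add: mult_ac)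
  then show ?thesis using False by simp
qed (simp add: \<open>0 \<le> b\<close>)

end


section \<open>Uniqueness and linearity of the Bochner integral\<close>

text \<open>
  In a non-separable space \<open>f - s\<close> and its norm need not be Borel measurable. The norm does agree
  almost everywhere with a limit of real-valued simple functions.
\<close>

lemma strongly_measurable_norm_diff:
  fixes f :: "'w \<Rightarrow> 'b::real_normed_vector"
  assumes "strongly_measurable M f" "simple_function M s"
  obtains g :: "'w \<Rightarrow> real"
  where "g \<in> borel_measurable M" "AE w in M. norm (f w - s w) = g w"
proof -
  obtain u where u: "\<And>i. simple_function M (u i)" "AE w in M. (\<lambda>i. u i w) \<longlonglongrightarrow> f w"
    using assms(1) unfolding strongly_measurable_def by blast
  have "(\<lambda>w. norm (u i w - s w)) \<in> borel_measurable M" for i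
    by (intro borel_measurable_simple_function simple_function_compose2[where h = "\<lambda>x y. norm (x - y)"] u assms)
  then have "(\<lambda>w. lim (\<lambda>i. norm (u i w - s w))) \<in> borel_measurable M"
    by (rule borel_measurable_lim_metric)
  moreover have "AE w in M. norm (f w - s w) = lim (\<lambda>i. norm (u i w - s w))"
    using u(2)
  proof eventually_elim
    case (elim w)
    then have "(\<lambda>i. norm (u i w - s w)) \<longlonglongrightarrow> norm (f w - s w)" by (intro tendsto_intros)
    then show ?case by (simp add: limI)
  qed
  ultimately show thesis using that by blast
qed

text \<open>
  Strong measurability enters through the functions \<open>g\<close> and \<open>h\<close> that replace \<open>\<parallel>f - s\<parallel>\<close> and
  \<open>\<parallel>f - t\<parallel>\<close>: for a nonmeasurable integrand the integral in \<open>[0, \<infinity>]\<close> is a lower integral, which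
  need not be subadditive.
\<close>

lemma simple_bochner_integral_dist_le:
  fixes f :: "'w \<Rightarrow> 'b::banach"
  assumes f: "strongly_measurable M f"
    and s: "Bochner_Integration.simple_bochner_integrable M s"
    and t: "Bochner_Integration.simple_bochner_integrable M t"
  shows "ennreal (norm (Bochner_Integration.simple_bochner_integral M s
        - Bochner_Integration.simple_bochner_integral M t))
      \<le> (\<integral>\<^sup>+w. ennreal (norm (f w - s w)) \<partial>M) + (\<integral>\<^sup>+w. ennreal (norm (f w - t w)) \<partial>M)"
proof -
  have sf: "simple_function M s" "simple_function M t"
    using s t by (auto elim: Bochner_Integration.simple_bochner_integrable.cases)
  obtain g where g[measurable]: "g \<in> borel_measurable M" and eg: "AE w in M. norm (f w - s w) = g w"
    by (rule strongly_measurable_norm_diff[OF f sf(1)])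
  obtain h where h[measurable]: "h \<in> borel_measurable M" and eh: "AE w in M. norm (f w - t w) = h w"
    by (rule strongly_measurable_norm_diff[OF f sf(2)])
  have st: "Bochner_Integration.simple_bochner_integrable M (\<lambda>w. s w - t w)"
    using Bochner_Integration.simple_bochner_integrable_compose2[of "(-)" M s t] s t by simp
  have "ennreal (norm (Bochner_Integration.simple_bochner_integral M s
        - Bochner_Integration.simple_bochner_integral M t))
      \<le> Bochner_Integration.simple_bochner_integral M (\<lambda>w. norm (s w - t w))"
    using Bochner_Integration.simple_bochner_integral_norm_bound[OF st]
    by (simp add: Bochner_Integration.simple_bochner_integral_diff[OF s t])
  also have "\<dots> = (\<integral>\<^sup>+w. ennreal (norm (s w - t w)) \<partial>M)"
    using Bochner_Integration.simple_bochner_integrable_compose2[of "\<lambda>x y. norm (x - y)" M s t] s t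
    by (intro Bochner_Integration.simple_bochner_integral_eq_nn_integral) simp_all
  also have "\<dots> \<le> (\<integral>\<^sup>+w. ennreal (g w) + ennreal (h w) \<partial>M)"
  proof (rule nn_integral_mono_AE)
    show "AE w in M. ennreal (norm (s w - t w)) \<le> ennreal (g w) + ennreal (h w)"
      using eg eh
    proof eventually_elim
      case (elim w)
      have "norm (s w - t w) \<le> g w + h w"
        using norm_triangle_ineq4[of "f w - t w" "f w - s w"] elim by simp
      moreover have "0 \<le> g w" "0 \<le> h w" using elim by (metis norm_ge_zero)+
      ultimately show ?case by (simp flip: ennreal_plus)
    qed
  qed
  also have "\<dots> = (\<integral>\<^sup>+w. ennreal (g w) \<partial>M) + (\<integral>\<^sup>+w. ennreal (h w) \<partial>M)"
    by (rule nn_integral_add) simp_all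
  also have "(\<integral>\<^sup>+w. ennreal (g w) \<partial>M) = (\<integral>\<^sup>+w. ennreal (norm (f w - s w)) \<partial>M)"
    using eg by (intro nn_integral_cong_AE) auto
  also have "(\<integral>\<^sup>+w. ennreal (h w) \<partial>M) = (\<integral>\<^sup>+w. ennreal (norm (f w - t w)) \<partial>M)"
    using eh by (intro nn_integral_cong_AE) auto
  finally show ?thesis .
qed

lemma bochner_has_integral_unique:
  fixes f :: "'w \<Rightarrow> 'b::banach"
  assumes "bochner_has_integral M f I" "bochner_has_integral M f J"
  shows "I = J"
proof -
  obtain s where s: "\<And>i. Bochner_Integration.simple_bochner_integrable M (s i)"
      "(\<lambda>i. \<integral>\<^sup>+w. ennreal (norm (f w - s i w)) \<partial>M) \<longlonglongrightarrow> 0"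
      "(\<lambda>i. Bochner_Integration.simple_bochner_integral M (s i)) \<longlonglongrightarrow> I"
    using assms(1) unfolding bochner_has_integral_def by blast
  obtain t where t: "\<And>i. Bochner_Integration.simple_bochner_integrable M (t i)"
      "(\<lambda>i. \<integral>\<^sup>+w. ennreal (norm (f w - t i w)) \<partial>M) \<longlonglongrightarrow> 0"
      "(\<lambda>i. Bochner_Integration.simple_bochner_integral M (t i)) \<longlonglongrightarrow> J"
    using assms(2) unfolding bochner_has_integral_def by blast
  have sm: "strongly_measurable M f" using assms(1) unfolding bochner_has_integral_def by blast
  have "(\<lambda>i. ennreal (norm (Bochner_Integration.simple_bochner_integral M (s i)
      - Bochner_Integration.simple_bochner_integral M (t i)))) \<longlonglongrightarrow> ennreal (norm (I - J))"
    by (intro tendsto_ennrealI tendsto_norm tendsto_diff s(3) t(3))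
  moreover have "(\<lambda>i. (\<integral>\<^sup>+w. ennreal (norm (f w - s i w)) \<partial>M)
      + (\<integral>\<^sup>+w. ennreal (norm (f w - t i w)) \<partial>M)) \<longlonglongrightarrow> 0"
    using tendsto_add[OF s(2) t(2)] by simp
  ultimately have "ennreal (norm (I - J)) \<le> 0"
    by (rule LIMSEQ_le) (use simple_bochner_integral_dist_le[OF sm s(1) t(1)] in blast)
  then show ?thesis by simp
qed

lemma bochner_has_integral_cong:
  assumes f: "bochner_has_integral M f I" and eq: "\<And>w. w \<in> space M \<Longrightarrow> f w = g w"
  shows "bochner_has_integral M g I"
proof -
  obtain u where "\<And>i. simple_function M (u i)" "AE w in M. (\<lambda>i. u i w) \<longlonglongrightarrow> f w"
    using f unfolding bochner_has_integral_def strongly_measurable_def by blast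
  moreover from this(2) AE_space have "AE w in M. (\<lambda>i. u i w) \<longlonglongrightarrow> g w"
    by eventually_elim (simp add: eq)
  ultimately have "strongly_measurable M g" unfolding strongly_measurable_def by blast
  moreover have "(\<integral>\<^sup>+w. ennreal (norm (f w - s w)) \<partial>M) = (\<integral>\<^sup>+w. ennreal (norm (g w - s w)) \<partial>M)" for s
    by (rule nn_integral_cong) (simp add: eq)
  ultimately show ?thesis
    using f unfolding bochner_has_integral_def by simp
qed

lemma bochner_has_integral_bounded_linear:
  fixes L :: "'b::banach \<Rightarrow> 'c::banach"
  assumes L: "bounded_linear L" and f: "bochner_has_integral M f I"
  shows "bochner_has_integral M (\<lambda>w. L (f w)) (L I)"
proof -
  interpret L: bounded_linear L by fact
  have sm: "strongly_measurable M f" using f unfolding bochner_has_integral_def by blast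
  obtain u where u: "\<And>i. simple_function M (u i)" "AE w in M. (\<lambda>i. u i w) \<longlonglongrightarrow> f w"
    using sm unfolding strongly_measurable_def by blast
  have "strongly_measurable M (\<lambda>w. L (f w))"
    unfolding strongly_measurable_def
  proof (intro exI[of _ "\<lambda>i w. L (u i w)"] conjI allI)
    show "simple_function M (\<lambda>w. L (u i w))" for i by (rule simple_function_compose1[OF u(1)])
    show "AE w in M. (\<lambda>i. L (u i w)) \<longlonglongrightarrow> L (f w)"
      using u(2) by eventually_elim (rule L.tendsto)
  qed
  moreover obtain s where s: "\<And>i. Bochner_Integration.simple_bochner_integrable M (s i)"
      "(\<lambda>i. \<integral>\<^sup>+w. ennreal (norm (f w - s i w)) \<partial>M) \<longlonglongrightarrow> 0"
      "(\<lambda>i. Bochner_Integration.simple_bochner_integral M (s i)) \<longlonglongrightarrow> I"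
    using f unfolding bochner_has_integral_def by blast
  obtain C where C: "0 \<le> C" "\<And>x. norm (L x) \<le> norm x * C" using L.nonneg_bounded by blast
  have "(\<lambda>i. \<integral>\<^sup>+w. ennreal (norm (L (f w) - L (s i w))) \<partial>M) \<longlonglongrightarrow> 0"
  proof (rule tendsto_sandwich[OF _ _ tendsto_const])
    show "(\<lambda>i. ennreal C * (\<integral>\<^sup>+w. ennreal (norm (f w - s i w)) \<partial>M)) \<longlonglongrightarrow> 0"
      using ennreal_tendsto_cmult[OF _ s(2), of "ennreal C"] by simp
    show "\<forall>\<^sub>F i in sequentially. (\<integral>\<^sup>+w. ennreal (norm (L (f w) - L (s i w))) \<partial>M)
        \<le> ennreal C * (\<integral>\<^sup>+w. ennreal (norm (f w - s i w)) \<partial>M)"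
    proof (intro always_eventually allI)
      fix i
      have "simple_function M (s i)"
        using s(1)[of i] by (auto elim: Bochner_Integration.simple_bochner_integrable.cases)
      then obtain g where g[measurable]: "g \<in> borel_measurable M"
          and eg: "AE w in M. norm (f w - s i w) = g w"
        by (rule strongly_measurable_norm_diff[OF sm])
      have "(\<integral>\<^sup>+w. ennreal (norm (L (f w) - L (s i w))) \<partial>M) \<le> (\<integral>\<^sup>+w. ennreal C * ennreal (g w) \<partial>M)"
      proof (rule nn_integral_mono_AE)
        show "AE w in M. ennreal (norm (L (f w) - L (s i w))) \<le> ennreal C * ennreal (g w)"
          using eg
        proof eventually_elim
          case (elim w)
          have "norm (L (f w) - L (s i w)) \<le> C * g w"
            using C(2)[of "f w - s i w"] elim by (simp add: L.diff mult.commute)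
          moreover have "0 \<le> g w" using elim by (metis norm_ge_zero)
          ultimately show ?case using C(1) by (simp flip: ennreal_mult)
        qed
      qed
      also have "\<dots> = ennreal C * (\<integral>\<^sup>+w. ennreal (g w) \<partial>M)"
        by (rule nn_integral_cmult) simp
      also have "(\<integral>\<^sup>+w. ennreal (g w) \<partial>M) = (\<integral>\<^sup>+w. ennreal (norm (f w - s i w)) \<partial>M)"
        using eg by (intro nn_integral_cong_AE) auto
      finally show "(\<integral>\<^sup>+w. ennreal (norm (L (f w) - L (s i w))) \<partial>M)
        \<le> ennreal C * (\<integral>\<^sup>+w. ennreal (norm (f w - s i w)) \<partial>M)" .
    qed
  qed simp
  moreover have "Bochner_Integration.simple_bochner_integrable M (\<lambda>w. L (s i w))" for i
    using Bochner_Integration.simple_bochner_integrable_compose2[of "\<lambda>x y. L x" M "s i" "s i"] s(1)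
    by (simp add: L.zero)
  moreover have "(\<lambda>i. Bochner_Integration.simple_bochner_integral M (\<lambda>w. L (s i w))) \<longlonglongrightarrow> L I"
    using L.tendsto[OF s(3)]
    by (simp add: Bochner_Integration.simple_bochner_integral_linear[OF L.linear_axioms s(1)])
  ultimately show ?thesis
    unfolding bochner_has_integral_def by (intro conjI exI[of _ "\<lambda>i w. L (s i w)"]) auto
qed


section \<open>The frame operator\<close>

lemma strictly_nonzero_invertible:
  assumes "strictly_nonzero a"
  shows "invertible_elt a"
  using assms invertible_elt_uminus[of "- a"] by (simp add: strictly_nonzero_def spectrum_def)

lemma norm_conjugate_le:
  fixes a b :: "'a::unital_cstar_algebra"
  shows "norm (b * a * star b) \<le> (norm b)\<^sup>2 * norm a"
  using norm_mult3_le[of b a "star b"] by (simp add: power2_eq_square mult_ac)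

theorem theorem2p4:
  fixes actU :: "'a::unital_cstar_algebra \<Rightarrow> 'u::banach \<Rightarrow> 'u"
    and ipU :: "'u \<Rightarrow> 'u \<Rightarrow> 'a"
    and actV :: "'a \<Rightarrow> 'v::banach \<Rightarrow> 'v"
    and ipV :: "'v \<Rightarrow> 'v \<Rightarrow> 'a"
    and M :: "'w measure"
    and Vw :: "'w \<Rightarrow> 'v set"
    and K S :: "'u \<Rightarrow> 'u"
    and \<Lambda> :: "'w \<Rightarrow> 'u \<Rightarrow> 'v"
    and A B :: 'a
  assumes "hilbert_module actU ipU"
    and "hilbert_module actV ipV"
    and "\<And>w. w \<in> space M \<Longrightarrow> closed_submodule actV (Vw w)"
    and "K \<in> adjointable ipU ipU UNIV"
    and "continuous_star_K_g_frame ipU ipV M Vw K \<Lambda> A B"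
    and "is_frame_operator ipU ipV M \<Lambda> S"
  shows "bounded_linear S \<and> positive_op ipU S \<and> selfadjoint_op ipU S \<and>
    norm (inverse_elt A) powi (-2) * (onorm K)\<^sup>2 \<le> onorm S \<and>
    onorm S \<le> (norm B)\<^sup>2"
proof -
  interpret U: hilbert_module actU ipU by fact
  interpret V: hilbert_module actV ipV by fact
  let ?K' = "adjoint_op ipU ipU K"
  have K_adj: "ipU (K x) y = ipU x (?K' y)" for x y
    by (rule adjoint_op_eq[OF assms(1,4)]) simp
  note frame = assms(5)[unfolded continuous_star_K_g_frame_def]
  \<comment> \<open>The weak form \<open>\<langle>Sx, y\<rangle> = \<integral> \<langle>\<Lambda>\<^sub>w x, \<Lambda>\<^sub>w y\<rangle> d\<mu>\<close> of the definition of \<open>S\<close>.\<close>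
  have weak: "bochner_has_integral M (\<lambda>w. ipV (\<Lambda> w x) (\<Lambda> w y)) (ipU (S x) y)" for x y
  proof (rule bochner_has_integral_cong)
    show "bochner_has_integral M (\<lambda>w. ipU (adjoint_op ipU ipV (\<Lambda> w) (\<Lambda> w x)) y) (ipU (S x) y)"
      using assms(6) bochner_has_integral_bounded_linear[OF U.bounded_linear_ip_left]
      unfolding is_frame_operator_def by blast
    show "ipU (adjoint_op ipU ipV (\<Lambda> w) (\<Lambda> w x)) y = ipV (\<Lambda> w x) (\<Lambda> w y)" if "w \<in> space M" for w
    proof -
      have ad: "\<Lambda> w \<in> adjointable ipU ipV (Vw w)" using frame that by blast
      moreover have "\<Lambda> w x \<in> Vw w" using ad unfolding adjointable_def by blast
      ultimately have "ipV (\<Lambda> w y) (\<Lambda> w x) = ipU y (adjoint_op ipU ipV (\<Lambda> w) (\<Lambda> w x))"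
        by (rule adjoint_op_eq[OF assms(1)])
      then show ?thesis using U.ip_star V.ip_star by metis
    qed
  qed
  \<comment> \<open>Exchanging \<open>x\<close> and \<open>y\<close> applies the involution to the integrand of \<open>weak\<close>, hence to the integral.\<close>
  have sym: "ipU (S x) y = ipU x (S y)" for x y
  proof -
    have "bochner_has_integral M (\<lambda>w. star (ipV (\<Lambda> w y) (\<Lambda> w x))) (star (ipU (S y) x))"
      by (rule bochner_has_integral_bounded_linear[OF bounded_linear_star weak])
    then have "bochner_has_integral M (\<lambda>w. ipV (\<Lambda> w x) (\<Lambda> w y)) (ipU x (S y))"
      by (simp flip: U.ip_star V.ip_star)
    then show ?thesis using bochner_has_integral_unique weak by blast
  qed
  have lower: "A * ipU (?K' x) (?K' x) * star A \<preceq> ipU (S x) x"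
    and upper: "ipU (S x) x \<preceq> B * ipU x x * star B" for x
    using frame bochner_has_integral_unique[OF weak[of x x]] by metis+
  have conj: "a * ipU x x * star a = ipU (actU a x) (actU a x)" for a x
    by (simp add: U.ip_act_left U.ip_act_right mult.assoc)
  \<comment> \<open>Conjugates \<open>a\<langle>x,x\<rangle>a\<^sup>*\<close> are again of the form \<open>\<langle>z,z\<rangle>\<close>, so their positivity is an axiom of the module.\<close>
  have pos: "positive_elt (ipU (S x) x)" for x
    using positive_elt_mono[OF _ lower] U.ip_pos unfolding conj by blast
  have quad: "norm (ipU (S x) x) \<le> (norm B)\<^sup>2 * (norm x)\<^sup>2" for x
    using norm_mono_positive[OF pos upper] norm_conjugate_le[of B "ipU x x"] U.norm_ip_self[of x]
    by (metis order_trans)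
  have S_le: "norm (S x) \<le> (norm B)\<^sup>2 * norm x" for x
    by (rule U.positive_op_norm_le[OF sym pos quad]) simp
  have "linear S" by (rule U.adjoint_pair_linear[OF sym])
  then have S: "bounded_linear S"
    using S_le by (intro bounded_linear_intro[where K = "(norm B)\<^sup>2"]) (simp_all add: linear_add linear_scale mult.commute)
  have sa: "selfadjoint_op ipU S" by (rule U.symmetric_op_selfadjoint[OF sym])
  have "0 \<preceq> ipU (S x) x" for x
    using pos[of x] by (simp add: cstar_le_def positive_elt_def selfadjoint_elt_def)
  then have "positive_op ipU S" using sa unfolding positive_op_def selfadjoint_op_def by blast
  moreover have "onorm S \<le> (norm B)\<^sup>2" by (rule onorm_bound[OF _ S_le]) simp
  moreover have "norm (inverse_elt A) powi (-2) * (onorm K)\<^sup>2 \<le> onorm S"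
  proof -
    let ?n = "norm (inverse_elt A)" and ?s = "onorm S"
    have A: "A * inverse_elt A = 1" "inverse_elt A * A = 1"
      using inverse_elt_mult[OF strictly_nonzero_invertible] frame by blast+
    have n: "?n > 0" using A(1) by auto
    have s: "?s \<ge> 0" by (rule onorm_pos_le[OF S])
    have "norm (?K' x) \<le> ?n * sqrt ?s * norm x" for x
    proof -
      let ?k = "ipU (?K' x) (?K' x)"
      have "inverse_elt A * (A * ?k * star A) * star (inverse_elt A)
          = (inverse_elt A * A) * ?k * star (inverse_elt A * A)"
        by (simp only: star_mult mult.assoc)
      then have "?k = inverse_elt A * (A * ?k * star A) * star (inverse_elt A)"
        by (simp add: A)
      then have "norm ?k \<le> ?n\<^sup>2 * norm (A * ?k * star A)"
        using norm_conjugate_le by metis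
      also have "\<dots> \<le> ?n\<^sup>2 * norm (ipU (S x) x)"
        using norm_mono_positive[OF _ lower[of x]] U.ip_pos unfolding conj
        by (intro mult_left_mono) auto
      also have "\<dots> \<le> ?n\<^sup>2 * (?s * norm x * norm x)"
        using order_trans[OF U.norm_ip_le[of "S x" x] mult_right_mono[OF onorm[OF S, of x] norm_ge_zero]]
        by (rule mult_left_mono) simp
      also have "\<dots> = (?n * sqrt ?s * norm x)\<^sup>2"
        using s by (simp add: power_mult_distrib) (simp add: power2_eq_square)
      finally have "(norm (?K' x))\<^sup>2 \<le> (?n * sqrt ?s * norm x)\<^sup>2"
        by (simp only: U.norm_ip_self)
      then show ?thesis by (rule power2_le_imp_le) (simp add: s)
    qed
    then have K_le: "norm (K x) \<le> ?n * sqrt ?s * norm x" for x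
      by (rule U.adjoint_pair_norm_le[OF K_adj]) (simp_all add: s)
    then have "onorm K \<le> ?n * sqrt ?s" by (intro onorm_bound) (simp_all add: s)
    moreover have "0 \<le> onorm K"
    proof (rule onorm_pos_le)
      have "linear K" by (rule U.adjoint_pair_linear[OF K_adj])
      then show "bounded_linear K"
        using K_le by (intro bounded_linear_intro[where K = "?n * sqrt ?s"])
          (simp_all add: linear_add linear_scale mult.commute)
    qed
    ultimately have "(onorm K)\<^sup>2 \<le> (?n * sqrt ?s)\<^sup>2" by (rule power_mono)
    then have "(onorm K)\<^sup>2 \<le> ?n\<^sup>2 * ?s" using s by (simp add: power_mult_distrib)
    then show ?thesis using n by (simp add: power_int_minus field_simps)
  qed
  ultimately show ?thesis using S sa by blast
qed

end
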